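(* Let $(\Omega,\mathcal F,\mathbb P)$ be a probability space. For a random variable $Y$ and a $\sigma$-lattice $\mathcal A\subseteq\mathcal F$, the isotonic conditional law (ICL) $P_{Y\mid\mathcal A}$ minimizes $$\mathbb E\,\mathrm{CRPS}(G,Y)$$ over all random distributions $G$ in the class $$\mathscr G_{\mathcal A}=\{G\in\mathscr H\mid G(\cdot,(z,\infty))\text{ is }\mathcal A\text{-measurable for all }z\in\mathbb R\}.$$ The ICL $P_{Y\mid\mathcal A}$ is the unique minimizer in the sense that $P_{Y\mid\mathcal A}(\cdot,B)=G(\cdot,B)$ almost surely for all $B\in\mathcal B(\mathbb R)$, for any $G\in\mathscr G_{\mathcal A}$ that minimizes $\mathbb E\,\mathrm{CRPS}(G,Y)$ as well.
   Context: $\mathscr H$ is the family of all Markov kernels from $(\Omega,\mathcal F)$ into $(\mathbb R,\mathcal B(\mathbb R))$; elements are also regarded as random cdfs, with $G(z)=G(\cdot,(-\infty,z])$. For a cdf $F$ and $y\in\mathbb R$, $\mathrm{CRPS}(F,y)=\int_{\mathbb R}(F(z)-\mathbf 1_{\{y\le z\}})^2\,\mathrm dz$. A $\sigma$-lattice $\mathcal A\subseteq\mathcal F$ contains $\emptyset,\Omega$ and is closed under countable unions and intersections. A random variable $X$ is $\mathcal A$-measurable if $\{X>x\}\in\mathcal A$ for all $x\in\mathbb R$. For integrable $Z$, $\mathbb E(Z\mid\mathcal A)$ is the (a.s. unique) integrable $\mathcal A$-measurable random variable $X$ with $\mathbb E(Z\mathbf 1_A)\le\mathbb E(X\mathbf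 1_A)$ for all $A\in\mathcal A$ and $\mathbb E(X\mathbf 1_B)=\mathbb E(Z\mathbf 1_B)$ for all $B\in\sigma(X)$; $\mathbb P(B\mid\mathcal A)=\mathbb E(\mathbf 1_B\mid\mathcal A)$. The ICL $P_{Y\mid\mathcal A}$ is the (a.s. unique) Markov kernel from $(\Omega,\mathcal F)$ to $(\mathbb R,\mathcal B(\mathbb R))$ such that $P_{Y\mid\mathcal A}(\cdot,(y,\infty))$ is a version of $\mathbb P(Y>y\mid\mathcal A)$ for every $y\in\mathbb R$.
   Formalization: Uniqueness is stated for minimizers with finite expected CRPS; if the minimal expected CRPS is infinite (e.g. Y Cauchy, trivial σ-lattice), every member of the class is a minimizer and uniqueness fails. Minimality is unconditional. *)

theory Defs
  imports "HOL-Probability.Probability"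
begin

definition sigma_lattice :: "'a measure \<Rightarrow> 'a set set \<Rightarrow> bool" where
  "sigma_lattice M \<A> \<longleftrightarrow>
     \<A> \<subseteq> sets M \<and> {} \<in> \<A> \<and> space M \<in> \<A> \<and>
     (\<forall>S :: nat \<Rightarrow> 'a set. range S \<subseteq> \<A> \<longrightarrow> (\<Union>i. S i) \<in> \<A> \<and> (\<Inter>i. S i) \<in> \<A>)"

definition lattice_measurable :: "'a measure \<Rightarrow> 'a set set \<Rightarrow> ('a \<Rightarrow> real) \<Rightarrow> bool" where
  "lattice_measurable M \<A> X \<longleftrightarrow> (\<forall>x. {\<omega> \<in> space M. X \<omega> > x} \<in> \<A>)"

text \<open>
  Conditional expectations given a \<open>\<sigma>\<close>-lattice, conditional probabilities and isotonic conditional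
  laws are only determined almost surely; they are given as predicates that hold of all versions.
  The \<open>\<sigma>\<close>-algebra generated by \<open>X\<close> is \<^term>\<open>sets (vimage_algebra (space M) X borel)\<close>.
\<close>

definition is_lattice_cond_exp ::
    "'a measure \<Rightarrow> 'a set set \<Rightarrow> ('a \<Rightarrow> real) \<Rightarrow> ('a \<Rightarrow> real) \<Rightarrow> bool" where
  "is_lattice_cond_exp M \<A> Z X \<longleftrightarrow>
     integrable M X \<and> lattice_measurable M \<A> X \<and>
     (\<forall>A\<in>\<A>. (\<integral>\<omega>. Z \<omega> * indicator A \<omega> \<partial>M) \<le> (\<integral>\<omega>. X \<omega> * indicator A \<omega> \<partial>M)) \<and>
     (\<forall>B\<in>sets (vimage_algebra (space M) X borel).
        (\<integral>\<omega>. X \<omega> * indicator B \<omega> \<partial>M) = (\<integral>\<omega>. Z \<omega> * indicator B \<omega> \<partial>M))"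

definition is_lattice_cond_prob ::
    "'a measure \<Rightarrow> 'a set set \<Rightarrow> 'a set \<Rightarrow> ('a \<Rightarrow> real) \<Rightarrow> bool" where
  "is_lattice_cond_prob M \<A> B X \<longleftrightarrow> is_lattice_cond_exp M \<A> (indicator B) X"

abbreviation markov_kernels :: "'a measure \<Rightarrow> ('a \<Rightarrow> real measure) set" where
  "markov_kernels M \<equiv> M \<rightarrow>\<^sub>M prob_algebra borel"

definition is_ICL ::
    "'a measure \<Rightarrow> 'a set set \<Rightarrow> ('a \<Rightarrow> real) \<Rightarrow> ('a \<Rightarrow> real measure) \<Rightarrow> bool" where
  "is_ICL M \<A> Y P \<longleftrightarrow>
     P \<in> markov_kernels M \<and>
     (\<forall>y. is_lattice_cond_prob M \<A> {\<omega> \<in> space M. Y \<omega> > y} (\<lambda>\<omega>. measure (P \<omega>) {y<..}))"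

definition lattice_kernels :: "'a measure \<Rightarrow> 'a set set \<Rightarrow> ('a \<Rightarrow> real measure) set" where
  "lattice_kernels M \<A> =
     {G \<in> markov_kernels M. \<forall>z. lattice_measurable M \<A> (\<lambda>\<omega>. measure (G \<omega>) {z<..})}"

text \<open>The CRPS of a cdf and its expectation are integrals of nonnegative functions and may be \<open>\<infinity>\<close>.\<close>

definition crps :: "(real \<Rightarrow> real) \<Rightarrow> real \<Rightarrow> ennreal" where
  "crps F y = (\<integral>\<^sup>+z. ennreal ((F z - indicator {y..} z)\<^sup>2) \<partial>lborel)"

definition expected_crps ::
    "'a measure \<Rightarrow> ('a \<Rightarrow> real measure) \<Rightarrow> ('a \<Rightarrow> real) \<Rightarrow> ennreal" where
  "expected_crps M G Y = (\<integral>\<^sup>+\<omega>. crps (cdf (G \<omega>)) (Y \<omega>) \<partial>M)"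

text \<open>
  If \<open>Y\<close> is heavy-tailed, \<^const>\<open>expected_crps\<close> can be \<open>\<infinity>\<close> on the whole class (for instance \<open>Y\<close>
  Cauchy and \<open>\<A> = {\<emptyset>, \<Omega>}\<close>). Every member of the class is then a minimizer in the sense below, so
  uniqueness of minimizers can only be claimed when the minimal value is finite.
\<close>

definition crps_minimizer ::
    "'a measure \<Rightarrow> 'a set set \<Rightarrow> ('a \<Rightarrow> real) \<Rightarrow> ('a \<Rightarrow> real measure) \<Rightarrow> bool" where
  "crps_minimizer M \<A> Y G \<longleftrightarrow>
     is_arg_min (\<lambda>H. expected_crps M H Y) (\<lambda>H. H \<in> lattice_kernels M \<A>) G"

end

theory Submission
  imports Defs
begin

text \<open>
  By Tonelli's theorem the expected CRPS of a kernel \<open>G\<close> is the integral over \<open>z\<close> of the squared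
  \<open>L\<^sup>2\<close> distance between \<open>G(\<cdot>, (z, \<infinity>))\<close> and the indicator of \<open>{Y > z}\<close>. For fixed \<open>z\<close>, the lattice
  conditional probability \<open>X\<close> of that event is the projection of its indicator \<open>Z\<close> onto the cone of
  lattice measurable variables: writing \<open>W \<ge> 0\<close> as a mixture of the indicators of \<open>{W > t}\<close>
  turns the two defining properties into \<open>E(Z W) \<le> E(X W)\<close> and \<open>E(Z X) = E(X X)\<close>, whence
  \<open>E (Z - X)\<^sup>2 + E (X - W)\<^sup>2 \<le> E (Z - W)\<^sup>2\<close>. Integrating over \<open>z\<close> gives minimality. If \<open>G\<close> attains the
  finite minimum, the middle term vanishes, so almost surely the two cdfs agree at almost every \<open>z\<close>,
  and right-continuity makes the measures equal.
\<close>

text \<open>Since \<open>W x\<close> is the length of \<open>{0..<W x}\<close>, Tonelli's theorem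
  turns both sides into integrals over \<open>t\<close> of the quantities compared in
  \<open>le\<close>. In \<open>ennreal\<close> the exchange raises no integrability
  questions.\<close>

lemma (in sigma_finite_measure) nn_integral_layer_cake_mono:
  fixes W :: "'a \<Rightarrow> real" and U V :: "'a \<Rightarrow> ennreal"
  assumes [measurable]: "U \<in> borel_measurable M" "V \<in> borel_measurable M" "W \<in> borel_measurable M"
    and nonneg: "\<And>x. x \<in> space M \<Longrightarrow> 0 \<le> W x"
    and le: "\<And>t. 0 \<le> t \<Longrightarrow> (\<integral>\<^sup>+x. U x * indicator {x \<in> space M. t < W x} x \<partial>M)
                   \<le> (\<integral>\<^sup>+x. V x * indicator {x \<in> space M. t < W x} x \<partial>M)"
  shows "(\<integral>\<^sup>+x. U x * W x \<partial>M) \<le> (\<integral>\<^sup>+x. V x * W x \<partial>M)"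
proof -
  interpret pair_sigma_finite M lborel ..
  have layer_cake: "(\<integral>\<^sup>+x. T x * W x \<partial>M)
      = (\<integral>\<^sup>+t. (\<integral>\<^sup>+x. T x * indicator {x \<in> space M. t < W x} x \<partial>M) * indicator {0..} t \<partial>lborel)"
    if [measurable]: "T \<in> borel_measurable M" for T :: "'a \<Rightarrow> ennreal"
  proof -
    have "(\<integral>\<^sup>+x. T x * W x \<partial>M)
        = (\<integral>\<^sup>+x. (\<integral>\<^sup>+t. T x * (if 0 \<le> t \<and> t < W x then 1 else 0) \<partial>lborel) \<partial>M)"
    proof (rule nn_integral_cong)
      fix x assume x: "x \<in> space M"
      have "(\<integral>\<^sup>+t. (if 0 \<le> t \<and> t < W x then 1 else 0) \<partial>lborel) = (\<integral>\<^sup>+t. indicator {0..<W x} t \<partial>lborel)"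
        by (intro nn_integral_cong) (auto simp: indicator_def)
      also have "\<dots> = W x"
        using nonneg[OF x] by simp
      finally show "T x * W x = (\<integral>\<^sup>+t. T x * (if 0 \<le> t \<and> t < W x then 1 else 0) \<partial>lborel)"
        by (subst nn_integral_cmult) auto
    qed
    also have "\<dots> = (\<integral>\<^sup>+t. (\<integral>\<^sup>+x. T x * (if 0 \<le> t \<and> t < W x then 1 else 0) \<partial>M) \<partial>lborel)"
      by (rule Fubini'[symmetric]) measurable
    also have "\<dots> = (\<integral>\<^sup>+t. (\<integral>\<^sup>+x. T x * indicator {x \<in> space M. t < W x} x \<partial>M) * indicator {0..} t \<partial>lborel)"
      by (intro nn_integral_cong) (auto simp: indicator_def intro!: nn_integral_cong)
    finally show ?thesis .
  qed
  show ?thesis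
    unfolding layer_cake[OF assms(1)] layer_cake[OF assms(2)]
    by (intro nn_integral_mono) (auto split: split_indicator intro!: mult_right_mono le)
qed

text \<open>Conditional expectations are defined through Bochner integrals. On a probability space,
  products of functions with values in \<open>{0..1}\<close> are integrable, so the comparison
  carries over from \<open>ennreal\<close>.\<close>

lemma (in prob_space) integral_layer_cake_mono:
  fixes U V W :: "'a \<Rightarrow> real"
  assumes [measurable]: "U \<in> borel_measurable M" "V \<in> borel_measurable M" "W \<in> borel_measurable M"
    and U: "U \<in> space M \<rightarrow> {0..1}" and V: "V \<in> space M \<rightarrow> {0..1}" and W: "W \<in> space M \<rightarrow> {0..1}"
    and le: "\<And>t. 0 \<le> t \<Longrightarrow> (\<integral>x. U x * indicator {x \<in> space M. t < W x} x \<partial>M)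
                   \<le> (\<integral>x. V x * indicator {x \<in> space M. t < W x} x \<partial>M)"
  shows "(\<integral>x. U x * W x \<partial>M) \<le> (\<integral>x. V x * W x \<partial>M)"
proof -
  have nn: "(\<integral>\<^sup>+x. ennreal (T x) * ennreal (S x) \<partial>M) = ennreal (\<integral>x. T x * S x \<partial>M)"
    if [measurable]: "T \<in> borel_measurable M" "S \<in> borel_measurable M"
      and T: "T \<in> space M \<rightarrow> {0..1}" and S: "S \<in> space M \<rightarrow> {0..1}" for T S
  proof -
    have "(\<integral>\<^sup>+x. ennreal (T x) * ennreal (S x) \<partial>M) = (\<integral>\<^sup>+x. ennreal (T x * S x) \<partial>M)"
      using T S by (intro nn_integral_cong) (auto simp: ennreal_mult Pi_iff)
    also have "\<dots> = ennreal (\<integral>x. T x * S x \<partial>M)"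
      using T S
      by (intro nn_integral_eq_integral integrable_const_bound[where B = 1])
         (auto simp: Pi_iff abs_mult intro!: AE_I2 mult_le_one)
    finally show ?thesis .
  qed
  have ind: "(\<integral>\<^sup>+x. ennreal (T x) * indicator {x \<in> space M. t < W x} x \<partial>M)
      = ennreal (\<integral>x. T x * indicator {x \<in> space M. t < W x} x \<partial>M)"
    if "T \<in> borel_measurable M" "T \<in> space M \<rightarrow> {0..1}" for T t
    using nn[OF that(1) _ that(2), of "indicator {x \<in> space M. t < W x}"]
    by (simp add: ennreal_indicator)
  have "(\<integral>\<^sup>+x. ennreal (U x) * ennreal (W x) \<partial>M) \<le> (\<integral>\<^sup>+x. ennreal (V x) * ennreal (W x) \<partial>M)"
    using W by (intro nn_integral_layer_cake_mono) (auto simp: ind U V intro!: ennreal_leI le)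
  then have "ennreal (\<integral>x. U x * W x \<partial>M) \<le> ennreal (\<integral>x. V x * W x \<partial>M)"
    using U V W by (simp add: nn)
  \<comment> \<open>\<open>ennreal\<close> sends negative reals to 0, so the inequality returns to
    the reals only once the right side is known to be nonnegative.\<close>
  moreover have "0 \<le> (\<integral>x. V x * W x \<partial>M)"
    using V W by (intro integral_nonneg_AE AE_I2) (auto simp: Pi_iff)
  ultimately show ?thesis
    by (simp add: ennreal_le_iff)
qed

text \<open>Expanding around \<open>X\<close> leaves the cross term 2 E((Z - X)(X - W)), which is
  twice (E(ZX) - E(XX)) + (E(XW) - E(ZW)). The first bracket vanishes and the second is
  nonnegative.\<close>

lemma (in prob_space) lattice_cond_exp_pythagoras:
  fixes Z X W :: "'a \<Rightarrow> real"
  assumes X: "is_lattice_cond_exp M \<A> Z X"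
    and W: "lattice_measurable M \<A> W"
    and [measurable]: "Z \<in> borel_measurable M" "W \<in> borel_measurable M"
    and bounds: "Z \<in> space M \<rightarrow> {0..1}" "X \<in> space M \<rightarrow> {0..1}" "W \<in> space M \<rightarrow> {0..1}"
  shows "(\<integral>\<^sup>+\<omega>. ennreal ((Z \<omega> - X \<omega>)\<^sup>2) \<partial>M) + (\<integral>\<^sup>+\<omega>. ennreal ((X \<omega> - W \<omega>)\<^sup>2) \<partial>M)
    \<le> (\<integral>\<^sup>+\<omega>. ennreal ((Z \<omega> - W \<omega>)\<^sup>2) \<partial>M)"
proof -
  have [measurable]: "X \<in> borel_measurable M"
    using X by (auto simp: is_lattice_cond_exp_def)
  have level: "{x \<in> space M. t < X x} \<in> sets (vimage_algebra (space M) X borel)" for t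
  proof -
    have "{x \<in> space M. t < X x} = X -` {t<..} \<inter> space M" by auto
    then show ?thesis by (auto intro: in_vimage_algebra)
  qed
  have X_level: "(\<integral>x. Z x * indicator {x \<in> space M. t < X x} x \<partial>M)
      = (\<integral>x. X x * indicator {x \<in> space M. t < X x} x \<partial>M)" for t
    using X level[of t] by (simp add: is_lattice_cond_exp_def)
  \<comment> \<open>The level sets of \<open>X\<close> lie in \<sigma>(X), where the integrals of
    \<open>Z\<close> and \<open>X\<close> agree, so the layer-cake comparison with weight
    \<open>X\<close> applies in both directions.\<close>
  have ZX: "(\<integral>x. Z x * X x \<partial>M) = (\<integral>x. X x * X x \<partial>M)"
    by (rule antisym; rule integral_layer_cake_mono) (use bounds X_level in auto)
  \<comment> \<open>Level sets of \<open>W\<close> are only known to lie in \<open>\<A>\<close>,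
    where the definition gives one inequality.\<close>
  have W_level: "(\<integral>x. Z x * indicator {x \<in> space M. t < W x} x \<partial>M)
      \<le> (\<integral>x. X x * indicator {x \<in> space M. t < W x} x \<partial>M)" for t
    using X W by (simp add: is_lattice_cond_exp_def lattice_measurable_def)
  have ZW: "(\<integral>x. Z x * W x \<partial>M) \<le> (\<integral>x. X x * W x \<partial>M)"
    by (rule integral_layer_cake_mono) (use bounds W_level in auto)
  have int: "integrable M (\<lambda>x. T x * S x)"
    if [measurable]: "T \<in> borel_measurable M" "S \<in> borel_measurable M"
      and "T \<in> space M \<rightarrow> {0..1}" "S \<in> space M \<rightarrow> {0..1}" for T S :: "'a \<Rightarrow> real"
    using that by (intro integrable_const_bound[where B = 1])
      (auto simp: Pi_iff abs_mult intro!: AE_I2 mult_le_one)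
  have square: "(\<integral>x. (T x - S x)\<^sup>2 \<partial>M)
        = (\<integral>x. T x * T x \<partial>M) - 2 * (\<integral>x. T x * S x \<partial>M) + (\<integral>x. S x * S x \<partial>M)"
    and square_nn: "(\<integral>\<^sup>+x. ennreal ((T x - S x)\<^sup>2) \<partial>M) = ennreal (\<integral>x. (T x - S x)\<^sup>2 \<partial>M)"
    if "T \<in> borel_measurable M" "S \<in> borel_measurable M"
      and "T \<in> space M \<rightarrow> {0..1}" "S \<in> space M \<rightarrow> {0..1}" for T S :: "'a \<Rightarrow> real"
  proof -
    have eq: "(\<lambda>x. (T x - S x)\<^sup>2) = (\<lambda>x. T x * T x - 2 * (T x * S x) + S x * S x)"
      by (auto simp: power2_eq_square algebra_simps)
    show "(\<integral>x. (T x - S x)\<^sup>2 \<partial>M)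
        = (\<integral>x. T x * T x \<partial>M) - 2 * (\<integral>x. T x * S x \<partial>M) + (\<integral>x. S x * S x \<partial>M)"
      unfolding eq using that by (simp add: int)
    have "integrable M (\<lambda>x. (T x - S x)\<^sup>2)"
      unfolding eq using that by (simp add: int)
    then show "(\<integral>\<^sup>+x. ennreal ((T x - S x)\<^sup>2) \<partial>M) = ennreal (\<integral>x. (T x - S x)\<^sup>2 \<partial>M)"
      by (intro nn_integral_eq_integral) auto
  qed
  have "(\<integral>x. (Z x - X x)\<^sup>2 \<partial>M) + (\<integral>x. (X x - W x)\<^sup>2 \<partial>M) \<le> (\<integral>x. (Z x - W x)\<^sup>2 \<partial>M)"
    using ZX ZW bounds by (simp add: square)
  then show ?thesis
    using bounds by (simp add: square_nn ennreal_leI flip: ennreal_plus)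
qed

lemma kernel_real_distribution:
  assumes "G \<in> markov_kernels M" "\<omega> \<in> space M"
  shows "real_distribution (G \<omega>)"
proof -
  have "G \<omega> \<in> space (prob_algebra borel)"
    using assms by (rule measurable_space)
  then show ?thesis
    by (auto simp: space_prob_algebra real_distribution_def real_distribution_axioms_def
        dest: sets_eq_imp_space_eq)
qed

text \<open>Every exchange of the integrals over \<open>\<omega>\<close> and \<open>z\<close> rests
  on this joint measurability. The half-lines are sections of the measurable set of pairs with first
  coordinate below the second.\<close>

lemma kernel_tail_measurable:
  assumes G: "G \<in> markov_kernels M"
  shows "(\<lambda>(\<omega>, z). measure (G \<omega>) {z<..}) \<in> borel_measurable (M \<Otimes>\<^sub>M (lborel :: real measure))"
proof -
  let ?N = "M \<Otimes>\<^sub>M (lborel :: real measure)"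
  have "(\<lambda>p. measure (G (fst p)) {snd p<..}) \<in> borel_measurable ?N"
  proof (rule measure_measurable_subprob_algebra2)
    have "{x \<in> space (?N \<Otimes>\<^sub>M borel). snd (fst x) < snd x} \<in> sets (?N \<Otimes>\<^sub>M borel)"
      by measurable
    also have "{x \<in> space (?N \<Otimes>\<^sub>M borel). snd (fst x) < snd x} = (SIGMA x:space ?N. {snd x<..})"
      by (auto simp: space_pair_measure)
    finally show "(SIGMA x:space ?N. {snd x<..}) \<in> sets (?N \<Otimes>\<^sub>M borel)" .
    show "(\<lambda>p. G (fst p)) \<in> ?N \<rightarrow>\<^sub>M subprob_algebra borel"
      using measurable_prob_algebraD[OF G] by measurable
  qed
  then show ?thesis
    by (simp add: case_prod_beta)
qed

text \<open>Both the ICL and the class of kernels are described by upper tails. Passing to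
  complements gives F(z) - 1{y \<le> z} = 1{z < y} - (1 - F(z)).\<close>

lemma (in prob_space) expected_crps_eq_tail_distance:
  assumes [measurable]: "Y \<in> borel_measurable M" and G: "G \<in> markov_kernels M"
  shows "expected_crps M G Y
    = (\<integral>\<^sup>+z. (\<integral>\<^sup>+\<omega>. ennreal ((indicator {\<omega> \<in> space M. z < Y \<omega>} \<omega> - measure (G \<omega>) {z<..})\<^sup>2) \<partial>M) \<partial>lborel)"
proof -
  interpret pair_sigma_finite M lborel ..
  note [measurable] = kernel_tail_measurable[OF G]
  have "expected_crps M G Y
      = (\<integral>\<^sup>+\<omega>. (\<integral>\<^sup>+z. ennreal (((if z < Y \<omega> then 1 else 0) - measure (G \<omega>) {z<..})\<^sup>2) \<partial>lborel) \<partial>M)"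
    unfolding expected_crps_def crps_def
  proof (intro nn_integral_cong)
    fix \<omega> z assume \<omega>: "\<omega> \<in> space M"
    interpret G: real_distribution "G \<omega>"
      using G \<omega> by (rule kernel_real_distribution)
    have "measure (G \<omega>) {z<..} = 1 - cdf (G \<omega>) z"
    proof -
      have "space (G \<omega>) - {..z} = {z<..}"
        by auto
      then show ?thesis
        using G.prob_compl[of "{..z}"] by (simp add: cdf_def)
    qed
    then show "ennreal ((cdf (G \<omega>) z - indicator {Y \<omega>..} z)\<^sup>2)
        = ennreal (((if z < Y \<omega> then 1 else 0) - measure (G \<omega>) {z<..})\<^sup>2)"
      by (auto simp: indicator_def power2_commute)
  qed
  also have "\<dots> = (\<integral>\<^sup>+z. (\<integral>\<^sup>+\<omega>. ennreal (((if z < Y \<omega> then 1 else 0) - measure (G \<omega>) {z<..})\<^sup>2) \<partial>M) \<partial>lborel)"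
    by (rule Fubini'[symmetric]) measurable
  also have "\<dots> = (\<integral>\<^sup>+z. (\<integral>\<^sup>+\<omega>. ennreal ((indicator {\<omega> \<in> space M. z < Y \<omega>} \<omega> - measure (G \<omega>) {z<..})\<^sup>2) \<partial>M) \<partial>lborel)"
    by (intro nn_integral_cong) (auto simp: indicator_def)
  finally show ?thesis .
qed

text \<open>Cdfs are right-continuous, so agreement on a dense set suffices.\<close>

lemma real_distribution_eqI_AE_tail:
  assumes "real_distribution N" "real_distribution N'"
    and ae: "AE z in lborel. measure N {z<..} = measure N' {z<..}"
  shows "N = N'"
proof -
  interpret N: real_distribution N by fact
  interpret N': real_distribution N' by fact
  have cdf: "cdf L z = 1 - measure L {z<..}" if "real_distribution L" for L z
  proof -
    interpret L: real_distribution L by fact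
    have "space L - {z<..} = {..z}"
      by auto
    then show ?thesis
      using L.prob_compl[of "{z<..}"] by (simp add: cdf_def)
  qed
  have "cdf N x = cdf N' x" for x
  proof -
    have "((\<lambda>y. cdf N y - cdf N' y) \<longlongrightarrow> cdf N x - cdf N' x) (at_right x)"
      using N.cdf_is_right_cont[of x] N'.cdf_is_right_cont[of x]
      by (auto simp: continuous_within intro!: tendsto_diff)
    \<comment> \<open>Otherwise some \<open>{x<..<b}\<close> would lie in the exceptional null set
      despite its positive length. Hence the limit of the difference cannot be nonzero.\<close>
    moreover have "\<not> (\<forall>\<^sub>F y in at_right x. cdf N y - cdf N' y \<noteq> 0)"
    proof
      assume "\<forall>\<^sub>F y in at_right x. cdf N y - cdf N' y \<noteq> 0"
      then obtain b where b: "x < b" "\<And>y. x < y \<Longrightarrow> y < b \<Longrightarrow> cdf N y \<noteq> cdf N' y"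
        by (auto simp: eventually_at_right_field)
      have "AE z in lborel. z \<notin> {x<..<b}"
        using ae by eventually_elim (use b(2) cdf assms(1,2) in force)
      then have "emeasure lborel {x<..<b} = 0"
        by (subst (asm) AE_iff_measurable[of "{x<..<b}"]) auto
      then show False
        using b(1) by simp
    qed
    ultimately have "cdf N x - cdf N' x = 0"
      using tendsto_imp_eventually_ne by blast
    then show ?thesis
      by simp
  qed
  then show ?thesis
    by (intro cdf_unique assms(1,2)) auto
qed

theorem proposition4p1:
  fixes M :: "'a measure" and \<A> :: "'a set set" and Y :: "'a \<Rightarrow> real"
    and P :: "'a \<Rightarrow> real measure"
  assumes "prob_space M"
    and "Y \<in> borel_measurable M"
    and "sigma_lattice M \<A>"
    and "is_ICL M \<A> Y P"
  shows "crps_minimizer M \<A> Y P \<and>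
    (\<forall>G. crps_minimizer M \<A> Y G \<and> expected_crps M G Y < \<infinity> \<longrightarrow>
       (\<forall>B\<in>sets borel. AE \<omega> in M. measure (P \<omega>) B = measure (G \<omega>) B))"
proof -
  interpret prob_space M by fact
  interpret pair_sigma_finite M lborel ..
  note [measurable] = assms(2)
  have P: "P \<in> markov_kernels M" and P_lattice: "P \<in> lattice_kernels M \<A>"
    using assms(4) by (auto simp: is_ICL_def lattice_kernels_def is_lattice_cond_prob_def
        is_lattice_cond_exp_def)
  note [measurable] = kernel_tail_measurable[OF P]
  \<comment> \<open>The middle term of the Pythagorean inequality, integrated over \<open>z\<close>:
    minimality discards it, uniqueness forces it to vanish.\<close>
  define D where "D G = (\<integral>\<^sup>+z. (\<integral>\<^sup>+\<omega>. ennreal ((measure (P \<omega>) {z<..} - measure (G \<omega>) {z<..})\<^sup>2) \<partial>M) \<partial>lborel)"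
    for G :: "'a \<Rightarrow> real measure"
  have pythagoras: "expected_crps M P Y + D G \<le> expected_crps M G Y" if "G \<in> lattice_kernels M \<A>" for G
  proof -
    have G: "G \<in> markov_kernels M" and G_tail: "\<And>z. lattice_measurable M \<A> (\<lambda>\<omega>. measure (G \<omega>) {z<..})"
      using that by (auto simp: lattice_kernels_def)
    note [measurable] = kernel_tail_measurable[OF G]
    have unit: "(\<lambda>\<omega>. measure (H \<omega>) {z<..}) \<in> space M \<rightarrow> {0..1}" if "H \<in> markov_kernels M" for H z
      using kernel_real_distribution[OF that]
      by (auto intro!: prob_space.prob_le_1 simp: real_distribution_def)
    have "expected_crps M P Y + D G
        = (\<integral>\<^sup>+z. (\<integral>\<^sup>+\<omega>. ennreal ((indicator {\<omega> \<in> space M. z < Y \<omega>} \<omega> - measure (P \<omega>) {z<..})\<^sup>2) \<partial>M)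
          + (\<integral>\<^sup>+\<omega>. ennreal ((measure (P \<omega>) {z<..} - measure (G \<omega>) {z<..})\<^sup>2) \<partial>M) \<partial>lborel)"
      unfolding D_def expected_crps_eq_tail_distance[OF assms(2) P]
      by (rule nn_integral_add[symmetric]) measurable
    also have "\<dots> \<le> expected_crps M G Y"
      unfolding expected_crps_eq_tail_distance[OF assms(2) G]
    \<comment> \<open>For each \<open>z\<close>, \<open>Z\<close> is the indicator of {Y > z},
      \<open>X\<close> the tail of \<open>P\<close> and \<open>W\<close> the tail of
      \<open>G\<close>.\<close>
    proof (intro nn_integral_mono lattice_cond_exp_pythagoras[where \<A> = \<A>])
      show "is_lattice_cond_exp M \<A> (indicator {\<omega> \<in> space M. z < Y \<omega>}) (\<lambda>\<omega>. measure (P \<omega>) {z<..})" for z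
        using assms(4) by (auto simp: is_ICL_def is_lattice_cond_prob_def)
    qed (auto simp: unit P G G_tail indicator_def)
    finally show ?thesis .
  qed
  have minimal: "expected_crps M P Y \<le> expected_crps M G Y" if "G \<in> lattice_kernels M \<A>" for G
    using pythagoras[OF that] by (rule order_trans[rotated]) simp
  have "AE \<omega> in M. measure (P \<omega>) B = measure (G \<omega>) B"
    if "crps_minimizer M \<A> Y G" and fin: "expected_crps M G Y < \<infinity>" for G B
  proof -
    have G_lattice: "G \<in> lattice_kernels M \<A>" and "\<not> expected_crps M P Y < expected_crps M G Y"
      using that P_lattice by (auto simp: crps_minimizer_def is_arg_min_def)
    then have G: "G \<in> markov_kernels M" and "expected_crps M G Y \<le> expected_crps M P Y"
      by (auto simp: lattice_kernels_def)
    note [measurable] = kernel_tail_measurable[OF G]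
    \<comment> \<open>The explicit \<open>+ 0\<close> prepares cancellation, which in
      \<open>ennreal\<close> requires the common summand to be finite; this is where
      \<open>fin\<close> enters.\<close>
    have "expected_crps M P Y + D G \<le> expected_crps M P Y + 0"
      unfolding add_0_right
      using pythagoras[OF G_lattice] \<open>expected_crps M G Y \<le> expected_crps M P Y\<close> by (rule order_trans)
    moreover have "expected_crps M P Y \<noteq> \<infinity>"
      using minimal[OF G_lattice] fin by auto
    ultimately have "D G = 0"
      by (simp add: ennreal_add_left_cancel_le del: add_0_right)
    \<comment> \<open>With \<open>\<omega>\<close> outermost, vanishing of the integral yields a
      single null set of \<open>\<omega>\<close>, outside which the two tails agree for almost every
      \<open>z\<close>.\<close>
    also have "D G = (\<integral>\<^sup>+\<omega>. (\<integral>\<^sup>+z. ennreal ((measure (P \<omega>) {z<..} - measure (G \<omega>) {z<..})\<^sup>2) \<partial>lborel) \<partial>M)"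
      unfolding D_def by (rule Fubini') measurable
    finally have "AE \<omega> in M. (\<integral>\<^sup>+z. ennreal ((measure (P \<omega>) {z<..} - measure (G \<omega>) {z<..})\<^sup>2) \<partial>lborel) = 0"
      by (rule iffD1[OF nn_integral_0_iff_AE, rotated]) measurable
    then show ?thesis
    proof (rule AE_mp, intro AE_I2 impI)
      fix \<omega> assume \<omega>: "\<omega> \<in> space M"
        and "(\<integral>\<^sup>+z. ennreal ((measure (P \<omega>) {z<..} - measure (G \<omega>) {z<..})\<^sup>2) \<partial>lborel) = 0"
      then have "AE z in lborel. ennreal ((measure (P \<omega>) {z<..} - measure (G \<omega>) {z<..})\<^sup>2) = 0"
        using \<omega> by (intro iffD1[OF nn_integral_0_iff_AE]) measurable
      then have "AE z in lborel. measure (P \<omega>) {z<..} = measure (G \<omega>) {z<..}"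
        by (rule eventually_mono) simp
      \<comment> \<open>The laws coincide as measures, so one exceptional null set serves all
        \<open>B\<close> at once.\<close>
      then have "P \<omega> = G \<omega>"
        by (intro real_distribution_eqI_AE_tail kernel_real_distribution[OF P \<omega>]
            kernel_real_distribution[OF G \<omega>])
      then show "measure (P \<omega>) B = measure (G \<omega>) B"
        by simp
    qed
  qed
  then have "\<forall>G. crps_minimizer M \<A> Y G \<and> expected_crps M G Y < \<infinity> \<longrightarrow>
       (\<forall>B\<in>sets borel. AE \<omega> in M. measure (P \<omega>) B = measure (G \<omega>) B)"
    by (intro allI impI ballI) (elim conjE)
  moreover have "crps_minimizer M \<A> Y P"
    using P_lattice minimal by (auto simp: crps_minimizer_def is_arg_min_def not_less)
  ultimately show ?thesis
    by (rule conjI[rotated])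
qed

end
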